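(* Let $J$ be a nonempty proper subset of $\langle n \rangle = \{1,\dots,n\}$, and let $A=(a_{ij}),B=(b_{ij}) \in \mathbb{R}^{n \times n}$ be such that $\max\{a_{ii}, b_{ii}\} < 0$ for all $i \in \langle n \rangle$. Then every matrix in the interval hull $\mathbb{I}(A,B)$ is an $N$-matrix of the first category with respect to $J$ if and only if $I_z$ is an $N$-matrix of the first category with respect to $J$ for all $z \in \{\pm 1\}^n \setminus \{e^J, -e^J\}$.
   Context: For $A=(a_{ij}), B=(b_{ij}) \in \mathbb{R}^{n\times n}$, the interval hull is $\mathbb{I}(A,B) = \{C \in \mathbb{R}^{n\times n} : c_{ij} = t_{ij} a_{ij} + (1-t_{ij}) b_{ij},\ t_{ij} \in [0,1]\}$, where the $t_{ij}$ are chosen independently for each entry. Define the $n \times n$ matrices $(I_u)_{ij} = \max\{a_{ij},b_{ij}\}$, $(I_l)_{ij} = \min\{a_{ij},b_{ij}\}$, $I_c = \frac{A+B}{2}$, $\Delta = \frac{I_u - I_l}{2}$. For $z=(z_1,\dots,z_n) \in \{\pm 1\}^n$, let $D_z = \mathrm{diag}(z_1,\dots,z_n)$ and $I_z = I_c - D_z \Delta D_z$. For $J \subseteq \langle n \rangle$, $e^J \in \mathbb{R}^n$ is the vector with $e^J_i = 1$ for $i \in J$ and $e^J_i = -1$ for $i \notin J$. A real $n \times n$ matrix is an $N$-matrix if all its principal minors (including the determinant) are negative. Write $J^\complement = \langle n \rangle \setminus J$, and let $M_{KL}$ denote the submatrix of $M$ with rows indexed by $K$ and columns indexed by $L$; matrix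 inequalities are entrywise. For a nonempty proper subset $J$ of $\langle n\rangle$, an $N$-matrix $M \in \mathbb{R}^{n\times n}$ is of the first category with respect to $J$ if $M_{JJ} < 0$, $M_{J^\complement J^\complement} < 0$, $M_{J J^\complement} > 0$ and $M_{J^\complement J} > 0$. *)

theory Defs
  imports "Jordan_Normal_Form.Determinant" "Jordan_Normal_Form.DL_Submatrix"
begin

text \<open>
  The index set \<open>\<langle>n\<rangle> = {1,\<dots>,n}\<close> is rendered as \<open>{..<n}\<close>, following the zero-based indexing
  of the matrix library.
\<close>

definition interval_hull :: "real mat \<Rightarrow> real mat \<Rightarrow> real mat set" where
  "interval_hull A B =
     {C \<in> carrier_mat (dim_row A) (dim_col A).
        \<exists>t :: nat \<Rightarrow> nat \<Rightarrow> real. \<forall>i < dim_row A. \<forall>j < dim_col A.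
          t i j \<in> {0..1} \<and> C $$ (i, j) = t i j * A $$ (i, j) + (1 - t i j) * B $$ (i, j)}"

definition I_u :: "real mat \<Rightarrow> real mat \<Rightarrow> real mat" where
  "I_u A B = mat (dim_row A) (dim_col A) (\<lambda>(i, j). max (A $$ (i, j)) (B $$ (i, j)))"

definition I_l :: "real mat \<Rightarrow> real mat \<Rightarrow> real mat" where
  "I_l A B = mat (dim_row A) (dim_col A) (\<lambda>(i, j). min (A $$ (i, j)) (B $$ (i, j)))"

definition I_c :: "real mat \<Rightarrow> real mat \<Rightarrow> real mat" where
  "I_c A B = (1 / 2) \<cdot>\<^sub>m (A + B)"

definition Delta :: "real mat \<Rightarrow> real mat \<Rightarrow> real mat" where
  "Delta A B = (1 / 2) \<cdot>\<^sub>m (I_u A B - I_l A B)"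

definition sign_vecs :: "nat \<Rightarrow> real vec set" where
  "sign_vecs n = {z \<in> carrier_vec n. \<forall>i < n. z $ i \<in> {1, -1}}"

definition D_z :: "real vec \<Rightarrow> real mat" where
  "D_z z = mat_diag (dim_vec z) (\<lambda>i. z $ i)"

definition I_z :: "real mat \<Rightarrow> real mat \<Rightarrow> real vec \<Rightarrow> real mat" where
  "I_z A B z = I_c A B - D_z z * Delta A B * D_z z"

definition e_vec :: "nat \<Rightarrow> nat set \<Rightarrow> real vec" where
  "e_vec n J = vec n (\<lambda>i. if i \<in> J then 1 else -1)"

definition N_matrix :: "real mat \<Rightarrow> bool" where
  "N_matrix M \<longleftrightarrow> square_mat M \<and>
     (\<forall>K. K \<noteq> {} \<and> K \<subseteq> {..<dim_row M} \<longrightarrow> det (submatrix M K K) < 0)"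

definition entrywise_pos :: "real mat \<Rightarrow> bool" where
  "entrywise_pos M \<longleftrightarrow> (\<forall>i < dim_row M. \<forall>j < dim_col M. 0 < M $$ (i, j))"

definition entrywise_neg :: "real mat \<Rightarrow> bool" where
  "entrywise_neg M \<longleftrightarrow> (\<forall>i < dim_row M. \<forall>j < dim_col M. M $$ (i, j) < 0)"

definition N_matrix_first_category :: "nat set \<Rightarrow> real mat \<Rightarrow> bool" where
  "N_matrix_first_category J M \<longleftrightarrow>
     (let Jc = {..<dim_row M} - J in
        N_matrix M \<and>
        entrywise_neg (submatrix M J J) \<and> entrywise_neg (submatrix M Jc Jc) \<and>
        entrywise_pos (submatrix M J Jc) \<and> entrywise_pos (submatrix M Jc J))"

end

theory Submission
  imports Defs
begin

text \<open>
  Let \<open>s\<close> be the sign vector of \<open>J\<close>. For a matrix \<open>M\<close> with \<open>s\<^sub>i s\<^sub>j M\<^sub>i\<^sub>j < 0\<close> for all \<open>i, j\<close>,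
  being an \<open>N\<close>-matrix is equivalent to the following: no \<open>x\<close> for which \<open>s\<^sub>i x\<^sub>i\<close> takes both signs
  satisfies \<open>x\<^sub>i (M x)\<^sub>i \<le> 0\<close> for all \<open>i\<close>. If \<open>z\<close> is the sign vector of \<open>x\<close>, then
  \<open>x\<^sub>i (I\<^sub>z x)\<^sub>i \<le> x\<^sub>i (C x)\<^sub>i\<close> for every \<open>C\<close> in the hull, so a violating \<open>x\<close> for \<open>C\<close> is one for \<open>I\<^sub>z\<close>,
  and \<open>z \<noteq> \<plusminus>s\<close> precisely because \<open>s\<^sub>i x\<^sub>i\<close> takes both signs.
\<close>

section \<open>Principal minors of diagonal shifts\<close>

text \<open>
  Principal submatrices of \<open>M + diag d\<close> are padded to size \<open>n\<close> by unit rows, which leaves the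
  determinant unchanged and makes minors for different \<open>K\<close> comparable by expansion along a row.
\<close>

definition embedded_block :: "nat \<Rightarrow> (nat \<Rightarrow> nat \<Rightarrow> real) \<Rightarrow> (nat \<Rightarrow> real) \<Rightarrow> nat set \<Rightarrow> real mat" where
  "embedded_block n M d K = mat n n (\<lambda>(i, j).
     if i \<in> K then M i j + (if i = j then d i else 0) else if i = j then 1 else 0)"

definition pminor :: "nat \<Rightarrow> (nat \<Rightarrow> nat \<Rightarrow> real) \<Rightarrow> (nat \<Rightarrow> real) \<Rightarrow> nat set \<Rightarrow> real" where
  "pminor n M d K = det (embedded_block n M d K)"

definition mixed_signs :: "nat \<Rightarrow> (nat \<Rightarrow> real) \<Rightarrow> bool" where
  "mixed_signs n x \<longleftrightarrow> (\<exists>i<n. 0 < x i) \<and> (\<exists>i<n. x i < 0)"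

text \<open>The weak sign reversal known from the Gale-Nikaido and Fiedler-Ptak characterisations of
  P-matrices; coordinates where \<open>x\<close> or \<open>M x\<close> vanishes are allowed.\<close>

definition reverses_signs :: "nat \<Rightarrow> (nat \<Rightarrow> nat \<Rightarrow> real) \<Rightarrow> (nat \<Rightarrow> real) \<Rightarrow> bool" where
  "reverses_signs n M x \<longleftrightarrow> (\<forall>i<n. x i * (\<Sum>j<n. M i j * x j) \<le> 0)"

lemma embedded_block_carrier [simp]: "embedded_block n M d K \<in> carrier_mat n n"
  by (simp add: embedded_block_def)

text \<open>Serves two purposes: with \<open>y\<close> a vector it computes a product, with
  \<open>y\<close> a row of cofactors a Laplace expansion.\<close>

lemma embedded_block_row_sum:
  assumes "i < n"
  shows "(\<Sum>j<n. embedded_block n M d K $$ (i, j) * y j) =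
    (if i \<in> K then (\<Sum>j<n. M i j * y j) + d i * y i else y i)"
proof -
  have delta: "(\<Sum>j<n. (if i = j then c else 0) * y j) = c * y i" for c :: real
    using assms by (subst sum.remove[of _ i]) auto
  have "(\<Sum>j<n. embedded_block n M d K $$ (i, j) * y j) =
      (\<Sum>j<n. (if i \<in> K then M i j * y j + (if i = j then d i else 0) * y j
        else (if i = j then 1 else 0) * y j))"
    using assms by (intro sum.cong) (auto simp: embedded_block_def algebra_simps)
  also have "\<dots> = (if i \<in> K then (\<Sum>j<n. M i j * y j) + d i * y i else y i)"
    using delta[of "d i"] delta[of 1] by (auto simp: sum.distrib)
  finally show ?thesis .
qed

lemma pminor_empty [simp]: "pminor n M d {} = 1"
proof -
  have "embedded_block n M d {} = 1\<^sub>m n"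
    by (intro eq_matI) (auto simp: embedded_block_def)
  then show ?thesis by (simp add: pminor_def)
qed

lemma pminor_cong:
  assumes "\<And>i. i \<in> K \<Longrightarrow> d i = e i"
  shows "pminor n M d K = pminor n M e K"
  unfolding pminor_def embedded_block_def using assms
  by (intro arg_cong[of _ _ det] eq_matI) auto

text \<open>The cofactor deletes row \<open>i\<close>, the only row affected by \<open>d i\<close>
  and by membership of \<open>i\<close> in the index set.\<close>

lemma cofactor_embedded_block_cong:
  assumes "i < n" "\<And>k. k < n \<Longrightarrow> k \<noteq> i \<Longrightarrow> (k \<in> K \<longleftrightarrow> k \<in> L) \<and> (k \<in> K \<longrightarrow> d k = e k)"
  shows "cofactor (embedded_block n M d K) i j = cofactor (embedded_block n M e L) i j"
  unfolding cofactor_def mat_delete_def embedded_block_def using assms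
  by (intro arg_cong2[of _ _ _ _ "(*)"] refl arg_cong[of _ _ det] eq_matI) auto

text \<open>Taking \<open>i\<close> out of \<open>K\<close> turns row \<open>i\<close> into a unit
  row, and expanding along it leaves exactly this cofactor.\<close>

lemma cofactor_embedded_block_diag:
  assumes "i < n"
  shows "cofactor (embedded_block n M d K) i i = pminor n M d (K - {i})"
proof -
  have "pminor n M d (K - {i}) = (\<Sum>j<n. embedded_block n M d (K - {i}) $$ (i, j) *
      cofactor (embedded_block n M d (K - {i})) i j)"
    unfolding pminor_def by (rule laplace_expansion_row) (use assms in auto)
  also have "\<dots> = cofactor (embedded_block n M d (K - {i})) i i"
    using embedded_block_row_sum[OF assms] by simp
  also have "\<dots> = cofactor (embedded_block n M d K) i i"
    using assms by (intro cofactor_embedded_block_cong) auto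
  finally show ?thesis by simp
qed

text \<open>A shifted minor is affine in each single shift, with the minor on \<open>K - {i}\<close>
  as slope: expand along row \<open>i\<close>, whose cofactors do not involve
  \<open>d i\<close>.\<close>

lemma pminor_split:
  assumes "i < n" "i \<in> K"
  shows "pminor n M (d(i := c)) K = pminor n M (d(i := 0)) K + c * pminor n M d (K - {i})"
proof -
  define cof where "cof j = cofactor (embedded_block n M d K) i j" for j
  have *: "pminor n M (d(i := c)) K = (\<Sum>j<n. M i j * cof j) + c * cof i" for c
  proof -
    have "pminor n M (d(i := c)) K = (\<Sum>j<n. embedded_block n M (d(i := c)) K $$ (i, j) *
        cofactor (embedded_block n M (d(i := c)) K) i j)"
      unfolding pminor_def by (rule laplace_expansion_row) (use assms in auto)
    also have "\<dots> = (\<Sum>j<n. embedded_block n M (d(i := c)) K $$ (i, j) * cof j)"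
      unfolding cof_def using assms
      by (intro sum.cong arg_cong2[of _ _ _ _ "(*)"] refl cofactor_embedded_block_cong) auto
    also have "\<dots> = (\<Sum>j<n. M i j * cof j) + c * cof i"
      using assms by (simp add: embedded_block_row_sum)
    finally show ?thesis .
  qed
  show ?thesis
    using *[of c] *[of 0] assms cofactor_embedded_block_diag[of i n M d K] by (simp add: cof_def)
qed

text \<open>
  In the expansion of a shifted minor as a polynomial in \<open>d\<close>, all coefficients are negative except
  that of the full product of the \<open>d k\<close>, which vanishes here.
\<close>

lemma pminor_zero_row_neg:
  assumes neg: "\<And>K. K \<subseteq> {..<n} \<Longrightarrow> K \<noteq> {} \<Longrightarrow> pminor n M (\<lambda>_. 0) K < 0"
    and "K \<subseteq> {..<n}" "i \<in> K" "d i = 0" "\<And>k. k \<in> K \<Longrightarrow> 0 \<le> d k"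
  shows "pminor n M d K < 0"
  using assms(2-)
proof (induction "card {j \<in> K. d j \<noteq> 0}" arbitrary: K d rule: less_induct)
  case less
  have fin: "finite K" using less.prems(1) finite_subset by blast
  show ?case
  proof (cases "\<exists>j\<in>K. d j \<noteq> 0")
    case False
    then have "pminor n M d K = pminor n M (\<lambda>_. 0) K" by (intro pminor_cong) auto
    then show ?thesis using neg[of K] less.prems by auto
  next
    case True
    then obtain j where j: "j \<in> K" "d j \<noteq> 0" by blast
    \<comment> \<open>Hence \<open>i\<close> survives in \<open>K - {j}\<close> with zero shift, and
      both terms of the split at \<open>j\<close> fall under the induction hypothesis.\<close>
    have ij: "i \<noteq> j" using j less.prems by auto
    have "pminor n M (d(j := 0)) K < 0"
    proof (rule less.hyps)
      show "card {k \<in> K. (d(j := 0)) k \<noteq> 0} < card {k \<in> K. d k \<noteq> 0}"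
        using fin j by (intro psubset_card_mono) auto
    qed (use less.prems in auto)
    moreover have "pminor n M d (K - {j}) < 0"
    proof (rule less.hyps)
      show "card {k \<in> K - {j}. d k \<noteq> 0} < card {k \<in> K. d k \<noteq> 0}"
        using fin j by (intro psubset_card_mono) auto
    qed (use less.prems ij in auto)
    moreover have "0 < d j" using j less.prems(4)[of j] by auto
    ultimately show ?thesis
      using pminor_split[of j n K M d "d j"] j less.prems(1)
      by (auto simp: mult_pos_neg add_neg_neg)
  qed
qed

text \<open>Setting one shift to zero makes the minor negative, so a nonnegative minor forces
  \<open>d i\<close> times the minor on \<open>K - {i}\<close> to be positive. Elements are then
  removed one at a time; \<open>L\<close> is proper because the minor on \<open>K\<close> itself may
  be zero.\<close>

lemma pminor_pos_subset:
  assumes neg: "\<And>K. K \<subseteq> {..<n} \<Longrightarrow> K \<noteq> {} \<Longrightarrow> pminor n M (\<lambda>_. 0) K < 0"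
    and K: "K \<subseteq> {..<n}" and d: "\<And>k. k \<in> K \<Longrightarrow> 0 \<le> d k" and nonneg: "0 \<le> pminor n M d K"
    and L: "L \<subset> K"
  shows "0 < pminor n M d L"
proof -
  have fin: "finite K" using K finite_subset by blast
  have step: "0 < pminor n M d (K' - {i})"
    if "K' \<subseteq> K" "0 \<le> pminor n M d K'" "i \<in> K'" for K' i
  proof -
    have "pminor n M (d(i := 0)) K' < 0"
      by (rule pminor_zero_row_neg[OF neg, of _ i]) (use that K d in auto)
    then have "0 < d i * pminor n M d (K' - {i})"
      using pminor_split[of i n K' M d "d i"] that K by auto
    then show ?thesis using d[of i] that by (auto simp: zero_less_mult_iff)
  qed
  have "0 < pminor n M d (K - N)" if "N \<noteq> {}" "N \<subseteq> K" for N
    using finite_subset[OF that(2) fin] that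
  proof (induction N rule: finite_ne_induct)
    case (singleton x)
    then show ?case using step[of K x] nonneg by auto
  next
    case (insert x F)
    then have "0 < pminor n M d (K - F - {x})" by (intro step) auto
    then show ?case by (simp add: set_diff_eq conj_ac)
  qed
  from this[of "K - L"] L show ?thesis by (auto simp: double_diff)
qed

text \<open>The slope in each shift is a minor on a smaller set, positive by
  \<open>pminor_pos_subset\<close>. The shifts can therefore be raised from \<open>d\<close> to
  \<open>e\<close> one coordinate at a time.\<close>

lemma pminor_pos_mono:
  assumes neg: "\<And>K. K \<subseteq> {..<n} \<Longrightarrow> K \<noteq> {} \<Longrightarrow> pminor n M (\<lambda>_. 0) K < 0"
    and K: "K \<subseteq> {..<n}" and d: "\<And>k. k \<in> K \<Longrightarrow> 0 \<le> d k" and pos: "0 < pminor n M d K"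
    and de: "\<And>k. k \<in> K \<Longrightarrow> d k \<le> e k"
  shows "0 < pminor n M e K"
proof -
  have fin: "finite K" using K finite_subset by blast
  have "0 < pminor n M (\<lambda>k. if k \<in> F then e k else d k) K" if "F \<subseteq> K" for F
    using finite_subset[OF that fin] that
  proof (induction F)
    case empty
    then show ?case using pos by simp
  next
    case (insert x F)
    define f where "f = (\<lambda>k. if k \<in> F then e k else d k)"
    have f: "0 \<le> f k" if "k \<in> K" for k using d[OF that] de[OF that] by (auto simp: f_def)
    have IH: "0 < pminor n M f K" using insert by (simp add: f_def)
    have x: "x \<in> K" "x < n" using insert K by auto
    have "0 < pminor n M f (K - {x})"
      by (rule pminor_pos_subset[OF neg K f]) (use IH x in auto)
    moreover have "f x \<le> e x" using insert de by (simp add: f_def)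
    moreover have "pminor n M (f(x := e x)) K = pminor n M f K + (e x - f x) * pminor n M f (K - {x})"
      using pminor_split[of x n K M f "e x"] pminor_split[of x n K M f "f x"] x
      by (simp add: algebra_simps)
    moreover have "(\<lambda>k. if k \<in> insert x F then e k else d k) = f(x := e x)"
      by (auto simp: f_def)
    ultimately show ?case using IH by (simp add: add_pos_nonneg)
  qed
  from this[of K] pminor_cong[of K "\<lambda>k. if k \<in> K then e k else d k" e] show ?thesis by simp
qed

text \<open>\<open>x\<close> is a nonzero kernel vector of the padded matrix: \<open>ker\<close>
  handles the rows in \<open>K\<close>, \<open>zero\<close> the unit rows.\<close>

lemma pminor_eq_zero:
  assumes ker: "\<And>i. i \<in> K \<Longrightarrow> i < n \<Longrightarrow> (\<Sum>j<n. M i j * x j) + d i * x i = 0"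
    and zero: "\<And>i. i < n \<Longrightarrow> i \<notin> K \<Longrightarrow> x i = 0" and "k < n" "x k \<noteq> 0"
  shows "pminor n M d K = 0"
  unfolding pminor_def
proof (subst det_0_iff_vec_prod_zero[OF embedded_block_carrier], intro exI conjI)
  show "vec n x \<noteq> 0\<^sub>v n" using assms(3,4) by (metis index_vec index_zero_vec(1))
  show "embedded_block n M d K *\<^sub>v vec n x = 0\<^sub>v n"
  proof (rule eq_vecI)
    fix i assume "i < dim_vec (0\<^sub>v n :: real vec)"
    then have i: "i < n" by simp
    have "(embedded_block n M d K *\<^sub>v vec n x) $ i = (\<Sum>j<n. embedded_block n M d K $$ (i, j) * x j)"
      using i by (auto simp: scalar_prod_def lessThan_atLeast0 carrier_matD[OF embedded_block_carrier] intro!: sum.cong)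
    also have "\<dots> = 0" using embedded_block_row_sum[OF i] ker zero i by simp
    finally show "(embedded_block n M d K *\<^sub>v vec n x) $ i = 0\<^sub>v n $ i" using i by simp
  qed (simp add: carrier_matD[OF embedded_block_carrier])
qed simp

section \<open>Sign reversal and negative principal minors\<close>

text \<open>Conjugation by the diagonal matrix of the signs \<open>s\<close>, which is its own
  inverse.\<close>

lemma signed_row_sum:
  fixes s x :: "nat \<Rightarrow> real"
  assumes "\<And>i. i < n \<Longrightarrow> s i * s i = 1"
  shows "s i * (\<Sum>j<n. M i j * x j) = (\<Sum>j<n. (s i * s j * M i j) * (s j * x j))"
  unfolding sum_distrib_left
proof (rule sum.cong)
  fix j assume "j \<in> {..<n}"
  then have "(s i * s j * M i j) * (s j * x j) = s i * M i j * x j * (s j * s j)" by simp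
  then show "s i * (M i j * x j) = (s i * s j * M i j) * (s j * x j)"
    using assms \<open>j \<in> {..<n}\<close> by simp
qed simp

lemma signed_row_sum_neg:
  fixes s x :: "nat \<Rightarrow> real"
  assumes s: "\<And>i. i < n \<Longrightarrow> s i * s i = 1"
    and M: "\<And>i j. i < n \<Longrightarrow> j < n \<Longrightarrow> s i * s j * M i j < 0"
    and x: "\<And>j. j < n \<Longrightarrow> 0 \<le> s j * x j" and "k < n" "x k \<noteq> 0" "i < n"
  shows "s i * (\<Sum>j<n. M i j * x j) < 0"
proof -
  have "s k \<noteq> 0" using s[OF \<open>k < n\<close>] by auto
  then have "0 < s k * x k" using x[of k] assms by (simp add: order_less_le)
  then have "(s i * s k * M i k) * (s k * x k) < 0" using M[of i k] assms mult_neg_pos by blast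
  moreover have "(\<Sum>j\<in>{..<n} - {k}. (s i * s j * M i j) * (s j * x j)) \<le> 0"
  proof (rule sum_nonpos)
    fix j assume "j \<in> {..<n} - {k}"
    then show "(s i * s j * M i j) * (s j * x j) \<le> 0"
      using mult_nonpos_nonneg[OF less_imp_le[OF M] x, of i j j] \<open>i < n\<close> by simp
  qed
  ultimately show ?thesis
    using signed_row_sum[where n = n and s = s and M = M and x = x and i = i] s
      sum.remove[of "{..<n}" k "\<lambda>j. (s i * s j * M i j) * (s j * x j)"] \<open>k < n\<close>
    by simp
qed

text \<open>After conjugation by \<open>s\<close> the matrix is entrywise negative and the nonzero
  vector has one weak sign, so every row sum is strictly of the opposite sign.\<close>

lemma not_mixed_row_sum:
  fixes s x :: "nat \<Rightarrow> real"
  assumes s: "\<And>i. i < n \<Longrightarrow> s i * s i = 1"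
    and M: "\<And>i j. i < n \<Longrightarrow> j < n \<Longrightarrow> s i * s j * M i j < 0"
    and x: "\<not> mixed_signs n (\<lambda>j. s j * x j)" and "k < n" "x k \<noteq> 0" "i < n"
  shows "(\<Sum>j<n. M i j * x j) \<noteq> 0" "x i \<noteq> 0 \<Longrightarrow> x i * (\<Sum>j<n. M i j * x j) < 0"
proof -
  let ?m = "\<Sum>j<n. M i j * x j"
  have si: "s i * s i = 1" using s assms by blast
  have cases: "(s i * ?m < 0 \<and> 0 \<le> s i * x i) \<or> (0 < s i * ?m \<and> s i * x i \<le> 0)"
  proof (cases "\<forall>j<n. 0 \<le> s j * x j")
    case True
    then show ?thesis using signed_row_sum_neg[where n = n and s = s and M = M and x = x and k = k and i = i] assms by auto
  next
    case False
    then have le: "s j * x j \<le> 0" if "j < n" for j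
      using x that unfolding mixed_signs_def by (meson not_le)
    \<comment> \<open>The nonpositive case is the nonnegative one for \<open>- x\<close>.\<close>
    then have "s i * (\<Sum>j<n. M i j * - x j) < 0"
      using assms by (intro signed_row_sum_neg[where n = n and s = s and k = k]) auto
    then show ?thesis using le assms by (simp add: sum_negf)
  qed
  then show "?m \<noteq> 0" by auto
  assume "x i \<noteq> 0"
  then have "s i * x i \<noteq> 0" using si by auto
  then have "(s i * x i) * (s i * ?m) < 0"
    using cases mult_pos_neg[of "s i * x i" "s i * ?m"] mult_neg_pos[of "s i * x i" "s i * ?m"]
    by linarith
  moreover have "(s i * x i) * (s i * ?m) = (s i * s i) * (x i * ?m)" by (simp only: mult_ac)
  ultimately show "x i * ?m < 0" using si by simp
qed

text \<open>Induction on the size of \<open>K\<close>. A nonnegative minor would make a column of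
  the adjugate of the padded block a sign-reversing vector; it then cannot be mixed, which
  contradicts a vanishing row sum.\<close>

lemma pminor_neg_if_no_reversal:
  assumes s: "\<And>i. i < n \<Longrightarrow> s i * s i = (1::real)"
    and M: "\<And>i j. i < n \<Longrightarrow> j < n \<Longrightarrow> s i * s j * M i j < 0"
    and no: "\<And>x. mixed_signs n (\<lambda>i. s i * x i) \<Longrightarrow> \<not> reverses_signs n M x"
    and "K \<subseteq> {..<n}" "K \<noteq> {}"
  shows "pminor n M (\<lambda>_. 0) K < 0"
  using assms(4,5)
proof (induction "card K" arbitrary: K rule: less_induct)
  case less
  have fin: "finite K" using less.prems(1) finite_subset by blast
  obtain i where i: "i \<in> K" "i < n" using less.prems by auto
  show ?case
  proof (rule ccontr)
    assume "\<not> ?thesis"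
    then have det_nonneg: "0 \<le> pminor n M (\<lambda>_. 0) K" by simp
    define H where "H = embedded_block n M (\<lambda>_. 0) K"
    \<comment> \<open>\<open>x\<close> is the \<open>i\<close>-th column of the adjugate of \<open>H\<close>, so \<open>H x = det H \<cdot> e\<^sub>i\<close>.\<close>
    define x where "x j = cofactor H i j" for j
    have H: "H \<in> carrier_mat n n" by (simp add: H_def)
    have Hx: "(\<Sum>l<n. H $$ (j, l) * x l) = (if j = i then pminor n M (\<lambda>_. 0) K else 0)"
      if "j < n" for j
    proof -
      have "(\<Sum>l<n. H $$ (j, l) * x l) = (H * adj_mat H) $$ (j, i)"
        using H that i by (auto simp: adj_mat_def x_def scalar_prod_def lessThan_atLeast0 intro!: sum.cong)
      also have "\<dots> = (if j = i then pminor n M (\<lambda>_. 0) K else 0)"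
        unfolding adj_mat(2)[OF H] using that i by (simp add: pminor_def H_def)
      finally show ?thesis .
    qed
    have rows: "(\<Sum>l<n. M j l * x l) = (if j = i then pminor n M (\<lambda>_. 0) K else 0)" if "j \<in> K" for j
      using Hx[of j] embedded_block_row_sum[of j n M "\<lambda>_. 0" K x] that less.prems(1)
      by (auto simp: H_def)
    have outside: "x j = 0" if "j < n" "j \<notin> K" for j
      using Hx[of j] embedded_block_row_sum[of j n M "\<lambda>_. 0" K x] that i by (auto simp: H_def)
    have xi: "x i = pminor n M (\<lambda>_. 0) (K - {i})"
      using i by (simp add: x_def H_def cofactor_embedded_block_diag)
    show False
    \<comment> \<open>A singleton is separate: removing \<open>i\<close> leaves the empty minor,
      which is 1 and not negative. There \<open>x\<close> is supported at \<open>i\<close> alone,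
      and the entry \<open>M i i\<close> would have to be both negative and nonnegative.\<close>
    proof (cases "K = {i}")
      case True
      then have "x i = 1" using xi by simp
      have not_mixed: "\<not> mixed_signs n (\<lambda>j. s j * x j)"
      proof
        assume "mixed_signs n (\<lambda>j. s j * x j)"
        then obtain a b where ab: "a < n" "b < n" "0 < s a * x a" "s b * x b < 0"
          by (auto simp: mixed_signs_def)
        have "a = i" using outside[of a] ab True by (cases "a = i") auto
        moreover have "b = i" using outside[of b] ab True by (cases "b = i") auto
        ultimately show False using ab by simp
      qed
      from not_mixed_row_sum(2)[where n = n and s = s and M = M and x = x and k = i and i = i]
        s M not_mixed \<open>x i = 1\<close> i rows[of i] det_nonneg
      show False by simp
    next
      case False
      \<comment> \<open>A second index supplies a row of \<open>M x\<close> that is zero, since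
        \<open>rows\<close> is nonzero at most at \<open>i\<close>.\<close>
      then obtain k where k: "k \<in> K" "k \<noteq> i" "k < n" using i less.prems by auto
      have "x i < 0"
        unfolding xi using fin i k less.prems by (intro less.hyps psubset_card_mono) auto
      have "reverses_signs n M x"
        unfolding reverses_signs_def
      proof (intro allI impI)
        fix j assume "j < n"
        consider "j = i" | "j \<in> K" "j \<noteq> i" | "j \<notin> K" by blast
        then show "x j * (\<Sum>l<n. M j l * x l) \<le> 0"
        proof cases
          case 1
          then show ?thesis
            using rows[of i] i \<open>x i < 0\<close> det_nonneg by (simp add: mult_nonpos_nonneg)
        next
          case 2
          then show ?thesis using rows[of j] by simp
        next
          case 3
          then show ?thesis using outside[of j] \<open>j < n\<close> by simp
        qed
      qed
      then have not_mixed: "\<not> mixed_signs n (\<lambda>j. s j * x j)" using no[of x] by auto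
      from not_mixed_row_sum(1)[where n = n and s = s and M = M and x = x and k = i and i = k]
        s M not_mixed \<open>x i < 0\<close> i k rows[of k] show False by simp
    qed
  qed
qed

text \<open>Reversal makes the shifts \<open>d\<close> nonnegative. The \<open>d\<close>-minor on
  the support \<open>K\<close> is zero, so the one on the smaller set \<open>P\<close> is positive.
  Passing to the larger shifts \<open>e\<close> keeps it positive, although \<open>y\<close> makes
  it zero.\<close>

lemma no_reversal_if_pminor_neg:
  assumes s: "\<And>i. i < n \<Longrightarrow> s i * s i = (1::real)"
    and M: "\<And>i j. i < n \<Longrightarrow> j < n \<Longrightarrow> s i * s j * M i j < 0"
    and neg: "\<And>K. K \<subseteq> {..<n} \<Longrightarrow> K \<noteq> {} \<Longrightarrow> pminor n M (\<lambda>_. 0) K < 0"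
    and mixed: "mixed_signs n (\<lambda>i. s i * x i)"
  shows "\<not> reverses_signs n M x"
proof
  assume rev: "reverses_signs n M x"
  define K where "K = {i. i < n \<and> x i \<noteq> 0}"
  define P where "P = {i. i < n \<and> 0 < s i * x i}"
  \<comment> \<open>The shifts are chosen so that \<open>x\<close> lies in the kernel of the \<open>K\<close>-block of \<open>M + diag d\<close>,
    and its restriction \<open>y\<close> in that of the \<open>P\<close>-block of \<open>M + diag e\<close>.\<close>
  define d where "d i = - (\<Sum>j<n. M i j * x j) / x i" for i
  define y where "y i = (if i \<in> P then x i else 0)" for i
  define e where "e i = - (\<Sum>j<n. M i j * y j) / x i" for i
  have x_nz: "x i \<noteq> 0" if "i \<in> P" for i using that by (auto simp: P_def)
  obtain p q where "p < n" "0 < s p * x p" and q: "q < n" "s q * x q < 0"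
    using mixed unfolding mixed_signs_def by blast
  then have p: "p \<in> P" by (simp add: P_def)
  have "q \<in> K" "q \<notin> P" using q by (auto simp: P_def K_def)
  moreover have "P \<subseteq> K" using x_nz by (auto simp: P_def K_def)
  ultimately have PK: "P \<subset> K" by blast
  have Kn: "K \<subseteq> {..<n}" by (auto simp: K_def)
  have d_nonneg: "0 \<le> d i" if "i \<in> K" for i
  proof -
    have "x i * (\<Sum>j<n. M i j * x j) \<le> 0" using rev that by (simp add: reverses_signs_def K_def)
    then show ?thesis unfolding d_def zero_le_divide_iff mult_le_0_iff by linarith
  qed
  have "pminor n M d K = 0"
    by (rule pminor_eq_zero[where x = x and k = q]) (use q in \<open>auto simp: K_def d_def\<close>)
  then have pos: "0 < pminor n M d P"
    by (intro pminor_pos_subset[OF neg Kn d_nonneg _ PK]) auto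
  \<comment> \<open>The difference \<open>e i - d i\<close> is row \<open>i\<close> of
    \<open>M\<close> applied to \<open>x - y\<close>, over \<open>x i\<close>. In signed coordinates
    \<open>x - y\<close> is the nonpositive part of \<open>x\<close>, and the negative signed
    entries turn it nonnegative.\<close>
  have "d i \<le> e i" if i: "i \<in> P" for i
  proof -
    have "0 \<le> (\<Sum>j<n. (s i * s j * M i j) * (s j * (x j - y j)))"
    proof (rule sum_nonneg)
      fix j assume "j \<in> {..<n}"
      then have "s i * s j * M i j \<le> 0" "s j * (x j - y j) \<le> 0"
        using M[of i j] i by (auto simp: y_def P_def)
      then show "0 \<le> (s i * s j * M i j) * (s j * (x j - y j))" by (rule mult_nonpos_nonpos)
    qed
    also have "\<dots> = s i * (\<Sum>j<n. M i j * (x j - y j))"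
      by (rule signed_row_sum[symmetric]) (rule s)
    finally have "0 \<le> s i * (\<Sum>j<n. M i j * (x j - y j))" .
    moreover have "0 < s i * x i" "s i * s i = 1" using i s by (auto simp: P_def)
    ultimately have "0 \<le> (s i * (\<Sum>j<n. M i j * (x j - y j))) / (s i * x i)"
      by (intro divide_nonneg_pos)
    also have "\<dots> = (\<Sum>j<n. M i j * (x j - y j)) / x i" using \<open>s i * s i = 1\<close> by auto
    also have "\<dots> = e i - d i"
      by (simp add: e_def d_def right_diff_distrib sum_subtractf diff_divide_distrib)
    finally show ?thesis by simp
  qed
  then have "0 < pminor n M e P"
    by (rule pminor_pos_mono[OF neg _ _ pos, rotated -1]) (use PK Kn d_nonneg in auto)
  moreover have "pminor n M e P = 0"
    by (rule pminor_eq_zero[where x = y and k = p])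
      (use p x_nz in \<open>auto simp: y_def e_def P_def\<close>)
  ultimately show False by simp
qed

section \<open>Matrices of the first category\<close>

text \<open>A permutation moving a point outside \<open>K\<close> meets an off-diagonal zero of a
  unit row, so the Leibniz sum collapses to permutations of \<open>K\<close>.\<close>

lemma pminor_permutes:
  assumes "K \<subseteq> {..<n}"
  shows "pminor n M (\<lambda>_. 0) K = (\<Sum>p | p permutes K. signof p * (\<Prod>i\<in>K. M i (p i)))"
proof -
  let ?H = "embedded_block n M (\<lambda>_. 0) K"
  have fin: "finite K" using assms finite_subset by blast
  have prod: "(\<Prod>i=0..<n. ?H $$ (i, p i)) = (if p permutes K then \<Prod>i\<in>K. M i (p i) else 0)"
    if p: "p permutes {0..<n}" for p
  proof (cases "p permutes K")
    case True
    have "(\<Prod>i=0..<n. ?H $$ (i, p i)) = (\<Prod>i\<in>K. ?H $$ (i, p i))"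
      using assms p True
      by (intro prod.mono_neutral_right) (auto simp: embedded_block_def permutes_not_in)
    also have "\<dots> = (\<Prod>i\<in>K. M i (p i))"
      using assms permutes_in_image[OF p]
      by (intro prod.cong) (auto simp: embedded_block_def subset_iff)
    finally show ?thesis using True by simp
  next
    case False
    then obtain i where "i \<notin> K" "p i \<noteq> i"
      using p permutes_superset[of p "{0..<n}" K] by blast
    moreover from this have "i < n" using permutes_not_in[OF p] by force
    moreover have "p i < n" using permutes_in_image[OF p, of i] \<open>i < n\<close> by simp
    ultimately have "?H $$ (i, p i) = 0" "i \<in> {0..<n}" by (auto simp: embedded_block_def)
    then show ?thesis using False by (auto intro!: prod_zero)
  qed
  have "pminor n M (\<lambda>_. 0) K =
      (\<Sum>p | p permutes {0..<n}. signof p * (if p permutes K then \<Prod>i\<in>K. M i (p i) else 0))"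
    unfolding pminor_def by (subst det_def'[of _ n]) (auto simp: prod intro!: sum.cong)
  also have "\<dots> = (\<Sum>p | p permutes K. signof p * (if p permutes K then \<Prod>i\<in>K. M i (p i) else 0))"
    using assms permutes_subset[of _ K "{0..<n}"]
    by (intro sum.mono_neutral_right) (auto simp: finite_permutations lessThan_atLeast0)
  finally show ?thesis by simp
qed

lemma bij_betw_pick:
  assumes "finite K"
  shows "bij_betw (pick K) {0..<card K} K"
proof (rule bij_betw_imageI)
  show "inj_on (pick K) {0..<card K}"
    by (intro strict_mono_on_imp_inj_on strict_mono_onI pick_mono) auto
  then have "card (pick K ` {0..<card K}) = card K" by (simp add: card_image)
  then show "pick K ` {0..<card K} = K"
    using assms by (intro card_subset_eq) (auto intro: pick_in_set)
qed

text \<open>Links the renumbered submatrices in \<open>N_matrix\<close> to padded minors: the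
  Leibniz formula is transported along the enumeration \<open>pick K\<close>, which preserves signs
  of permutations.\<close>

lemma det_principal_submatrix:
  assumes A: "A \<in> carrier_mat n n" and K: "K \<subseteq> {..<n}"
  shows "det (submatrix A K K) = pminor n (\<lambda>i j. A $$ (i, j)) (\<lambda>_. 0) K"
proof -
  let ?k = "card K" and ?f = "pick K" and ?g = "inv_into {0..<card K} (pick K)"
  have fin: "finite K" using K finite_subset by blast
  have bij: "bij_betw ?f {0..<?k} K" by (rule bij_betw_pick[OF fin])
  note inj = bij_betw_imp_inj_on[OF bij]
  have dim: "{i. i < n \<and> i \<in> K} = K" using K by auto
  have sub: "submatrix A K K = mat ?k ?k (\<lambda>(i, j). A $$ (?f i, ?f j))"
    using A by (simp add: submatrix_def dim)
  have "det (submatrix A K K) =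
      (\<Sum>p | p permutes {0..<?k}. signof p * (\<Prod>i=0..<?k. A $$ (?f i, ?f (p i))))"
    unfolding sub using permutes_in_image[of _ "{0..<?k}"]
    by (subst det_def'[of _ ?k]) (auto intro!: sum.cong prod.cong)
  also have "\<dots> = (\<Sum>p | p permutes K. signof p * (\<Prod>i\<in>K. A $$ (i, p i)))"
  proof (rule sum.reindex_bij_witness[where j = "map_permutation {0..<?k} ?f"
        and i = "map_permutation K ?g"])
    fix p assume "p \<in> {p. p permutes {0..<?k}}"
    then have p: "p permutes {0..<?k}" by simp
    show "map_permutation K ?g (map_permutation {0..<?k} ?f p) = p"
      by (rule map_permutation_compose_inv[OF bij p]) (use inj in auto)
    show "map_permutation {0..<?k} ?f p \<in> {p. p permutes K}"
      using map_permutation_permutes[OF bij p] by simp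
    have "(\<Prod>i\<in>K. A $$ (i, map_permutation {0..<?k} ?f p i)) =
        (\<Prod>i=0..<?k. A $$ (?f i, map_permutation {0..<?k} ?f p (?f i)))"
      by (rule prod.reindex_bij_betw[OF bij, symmetric])
    also have "\<dots> = (\<Prod>i=0..<?k. A $$ (?f i, ?f (p i)))"
      using map_permutation_apply[OF inj] by (intro prod.cong) auto
    finally show "signof (map_permutation {0..<?k} ?f p) *
        (\<Prod>i\<in>K. A $$ (i, map_permutation {0..<?k} ?f p i)) =
        signof p * (\<Prod>i=0..<?k. A $$ (?f i, ?f (p i)))"
      using sign_map_permutation[OF inj p] by simp
  next
    fix p assume "p \<in> {p. p permutes K}"
    then have p: "p permutes K" by simp
    have bij': "bij_betw ?g K {0..<?k}" by (rule bij_betw_inv_into[OF bij])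
    show "map_permutation {0..<?k} ?f (map_permutation K ?g p) = p"
      by (rule map_permutation_compose_inv[OF bij' p]) (use bij in \<open>auto simp: bij_betw_inv_into_right\<close>)
    show "map_permutation K ?g p \<in> {p. p permutes {0..<?k}}"
      using map_permutation_permutes[OF bij' p] by simp
  qed
  finally show ?thesis using pminor_permutes[OF K] by simp
qed

lemma submatrix_entries_iff:
  assumes A: "A \<in> carrier_mat n n" and "I \<subseteq> {..<n}" "J \<subseteq> {..<n}"
  shows "(\<forall>i < dim_row (submatrix A I J). \<forall>j < dim_col (submatrix A I J). P (submatrix A I J $$ (i, j)))
    \<longleftrightarrow> (\<forall>i\<in>I. \<forall>j\<in>J. P (A $$ (i, j)))"
proof -
  have dim: "{i. i < n \<and> i \<in> I} = I" "{i. i < n \<and> i \<in> J} = J" using assms by auto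
  have "finite I" "finite J" using assms finite_subset by blast+
  from this[THEN bij_betw_pick, THEN bij_betw_imp_surj_on]
  have "pick I ` {0..<card I} = I" "pick J ` {0..<card J} = J" .
  then have "(\<forall>i\<in>I. \<forall>j\<in>J. P (A $$ (i, j))) \<longleftrightarrow>
      (\<forall>i\<in>pick I ` {0..<card I}. \<forall>j\<in>pick J ` {0..<card J}. P (A $$ (i, j)))" by simp
  also have "\<dots> \<longleftrightarrow> (\<forall>i < dim_row (submatrix A I J). \<forall>j < dim_col (submatrix A I J).
      P (submatrix A I J $$ (i, j)))"
    using A by (auto simp: submatrix_def dim)
  finally show ?thesis by simp
qed

text \<open>The vector \<open>e_vec n J\<close> as a function, without its dimension.\<close>

definition block_sign :: "nat set \<Rightarrow> nat \<Rightarrow> real" where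
  "block_sign J i = (if i \<in> J then 1 else -1)"

text \<open>The four block inequalities merge into one signed inequality, under which the two
  preceding implications trade minors for sign reversal. Both resulting conditions can be compared
  entrywise across the hull.\<close>

lemma N_matrix_first_category_iff:
  assumes M: "M \<in> carrier_mat n n" and J: "J \<subseteq> {..<n}"
  shows "N_matrix_first_category J M \<longleftrightarrow>
    (\<forall>i<n. \<forall>j<n. block_sign J i * block_sign J j * M $$ (i, j) < 0) \<and>
    (\<forall>x. mixed_signs n (\<lambda>i. block_sign J i * x i) \<longrightarrow> \<not> reverses_signs n (\<lambda>i j. M $$ (i, j)) x)"
    (is "_ \<longleftrightarrow> ?signs \<and> ?no_reversal")
proof -
  let ?M = "\<lambda>i j. M $$ (i, j)" and ?Jc = "{..<n} - J"
  have s: "block_sign J i * block_sign J i = 1" for i by (simp add: block_sign_def)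
  have N: "N_matrix M \<longleftrightarrow> (\<forall>K. K \<noteq> {} \<and> K \<subseteq> {..<n} \<longrightarrow> pminor n ?M (\<lambda>_. 0) K < 0)"
    using M det_principal_submatrix[OF M] by (auto simp: N_matrix_def)
  have Jc: "?Jc \<subseteq> {..<n}" by auto
  have "entrywise_neg (submatrix M J J) \<and> entrywise_neg (submatrix M ?Jc ?Jc) \<and>
      entrywise_pos (submatrix M J ?Jc) \<and> entrywise_pos (submatrix M ?Jc J) \<longleftrightarrow>
      (\<forall>i\<in>J. \<forall>j\<in>J. M $$ (i, j) < 0) \<and> (\<forall>i\<in>?Jc. \<forall>j\<in>?Jc. M $$ (i, j) < 0) \<and>
      (\<forall>i\<in>J. \<forall>j\<in>?Jc. 0 < M $$ (i, j)) \<and> (\<forall>i\<in>?Jc. \<forall>j\<in>J. 0 < M $$ (i, j))"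
    unfolding entrywise_neg_def entrywise_pos_def
    using submatrix_entries_iff[OF M J J, of "\<lambda>c. c < 0"]
      submatrix_entries_iff[OF M Jc Jc, of "\<lambda>c. c < 0"]
      submatrix_entries_iff[OF M J Jc, of "\<lambda>c. 0 < c"]
      submatrix_entries_iff[OF M Jc J, of "\<lambda>c. 0 < c"] by simp
  also have "\<dots> \<longleftrightarrow> ?signs" (is "?blocks \<longleftrightarrow> _")
  proof
    assume ?blocks
    show ?signs
    proof (intro allI impI)
      fix i j assume "i < n" "j < n"
      with \<open>?blocks\<close> show "block_sign J i * block_sign J j * M $$ (i, j) < 0"
        by (cases "i \<in> J"; cases "j \<in> J") (simp_all add: block_sign_def)
    qed
  next
    assume ?signs
    then have "block_sign J i * block_sign J j * M $$ (i, j) < 0" if "i \<in> {..<n}" "j \<in> {..<n}" for i j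
      using that by simp
    note sgn = this[OF subsetD[OF J] subsetD[OF J]] this[OF subsetD[OF Jc] subsetD[OF Jc]]
      this[OF subsetD[OF J] subsetD[OF Jc]] this[OF subsetD[OF Jc] subsetD[OF J]]
    show ?blocks
    proof (intro conjI ballI)
      fix i j assume "i \<in> J" "j \<in> J"
      then show "M $$ (i, j) < 0" using sgn(1)[of i j] by (simp add: block_sign_def)
    next
      fix i j assume "i \<in> ?Jc" "j \<in> ?Jc"
      then show "M $$ (i, j) < 0" using sgn(2)[of i j] by (simp add: block_sign_def)
    next
      fix i j assume "i \<in> J" "j \<in> ?Jc"
      then show "0 < M $$ (i, j)" using sgn(3)[of i j] by (simp add: block_sign_def)
    next
      fix i j assume "i \<in> ?Jc" "j \<in> J"
      then show "0 < M $$ (i, j)" using sgn(4)[of i j] by (simp add: block_sign_def)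
    qed
  qed
  finally have "N_matrix_first_category J M \<longleftrightarrow> N_matrix M \<and> ?signs"
    using M by (simp add: N_matrix_first_category_def Let_def)
  moreover have "N_matrix M \<longleftrightarrow> ?no_reversal" if ?signs
  proof -
    have sgn: "block_sign J i * block_sign J j * M $$ (i, j) < 0" if "i < n" "j < n" for i j
      using \<open>?signs\<close> that by simp
    show ?thesis
    proof
      assume "N_matrix M"
      then have neg: "pminor n ?M (\<lambda>_. 0) K < 0" if "K \<subseteq> {..<n}" "K \<noteq> {}" for K
        using that by (simp add: N)
      show ?no_reversal
      proof (intro allI impI)
        fix x assume "mixed_signs n (\<lambda>i. block_sign J i * x i)"
        then show "\<not> reverses_signs n ?M x"
          by (rule no_reversal_if_pminor_neg[where s = "block_sign J", rotated -1])
            (simp_all add: s sgn neg)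
      qed
    next
      assume ?no_reversal
      show "N_matrix M"
        unfolding N
      proof (intro allI impI, elim conjE)
        fix K assume "K \<noteq> {}" "K \<subseteq> {..<n}"
        then show "pminor n ?M (\<lambda>_. 0) K < 0"
          by (intro pminor_neg_if_no_reversal[where s = "block_sign J"])
            (simp_all add: s sgn \<open>?no_reversal\<close>)
      qed
    qed
  qed
  ultimately show ?thesis by blast
qed

section \<open>The interval hull\<close>

lemma I_z_carrier [simp]:
  assumes "A \<in> carrier_mat n n" "B \<in> carrier_mat n n" "z \<in> carrier_vec n"
  shows "I_z A B z \<in> carrier_mat n n"
  using assms by (auto simp: I_z_def I_c_def Delta_def D_z_def I_u_def I_l_def mat_diag_def)

lemma I_z_index:
  assumes A: "A \<in> carrier_mat n n" and B: "B \<in> carrier_mat n n" and z: "z \<in> carrier_vec n"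
    and ij: "i < n" "j < n"
  shows "I_z A B z $$ (i, j) = (A $$ (i, j) + B $$ (i, j)) / 2 -
    z $ i * z $ j * (\<bar>A $$ (i, j) - B $$ (i, j)\<bar> / 2)"
proof -
  have D: "Delta A B \<in> carrier_mat n n" using A B by (auto simp: Delta_def I_u_def I_l_def)
  have DD: "D_z z * Delta A B = mat n n (\<lambda>(i, j). z $ i * Delta A B $$ (i, j))"
    unfolding D_z_def using z by (simp add: mat_diag_mult_left[OF D])
  have "D_z z * Delta A B * D_z z = mat n n (\<lambda>(i, j). z $ i * Delta A B $$ (i, j) * z $ j)"
    unfolding DD unfolding D_z_def using z
    by (simp, subst mat_diag_mult_right[of _ n n]) (auto intro!: eq_matI)
  moreover have "Delta A B $$ (i, j) = \<bar>A $$ (i, j) - B $$ (i, j)\<bar> / 2"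
    using A B ij by (simp add: Delta_def I_u_def I_l_def max_def min_def)
  ultimately show ?thesis
    using A B ij by (simp add: I_z_def I_c_def)
qed

text \<open>\<open>I_z\<close> is a vertex of the hull: as \<open>z $ i * z $ j\<close> is 1 or -1,
  every entry is an endpoint of its interval.\<close>

lemma I_z_in_interval_hull:
  assumes A: "A \<in> carrier_mat n n" and B: "B \<in> carrier_mat n n" and z: "z \<in> sign_vecs n"
  shows "I_z A B z \<in> interval_hull A B"
proof -
  have zc: "z \<in> carrier_vec n" using z by (simp add: sign_vecs_def)
  define t :: "nat \<Rightarrow> nat \<Rightarrow> real" where
    "t i j = (if I_z A B z $$ (i, j) = A $$ (i, j) then 1 else 0)" for i j
  have "t i j \<in> {0..1} \<and> I_z A B z $$ (i, j) = t i j * A $$ (i, j) + (1 - t i j) * B $$ (i, j)"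
    if ij: "i < n" "j < n" for i j
  proof -
    have "z $ i = 1 \<or> z $ i = -1" "z $ j = 1 \<or> z $ j = -1"
      using z ij by (simp_all add: sign_vecs_def)
    then have "z $ i * z $ j = 1 \<or> z $ i * z $ j = -1" by auto
    moreover have "(a + b) / 2 - w * (\<bar>a - b\<bar> / 2) = a \<or> (a + b) / 2 - w * (\<bar>a - b\<bar> / 2) = b"
      if "w = 1 \<or> w = -1" for a b w :: real
      using that by (cases "a < b") (auto simp: field_simps)
    ultimately have "I_z A B z $$ (i, j) = A $$ (i, j) \<or> I_z A B z $$ (i, j) = B $$ (i, j)"
      unfolding I_z_index[OF A B zc ij] by blast
    then show ?thesis by (auto simp: t_def)
  qed
  then show ?thesis
    using I_z_carrier[OF A B zc] unfolding interval_hull_def carrier_matD[OF A] by blast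
qed

lemma interval_hull_index_bounds:
  assumes A: "A \<in> carrier_mat n n" and C: "C \<in> interval_hull A B" and ij: "i < n" "j < n"
  shows "min (A $$ (i, j)) (B $$ (i, j)) \<le> C $$ (i, j)" "C $$ (i, j) \<le> max (A $$ (i, j)) (B $$ (i, j))"
proof -
  obtain t' :: "nat \<Rightarrow> nat \<Rightarrow> real" where "\<forall>i<n. \<forall>j<n. t' i j \<in> {0..1} \<and>
      C $$ (i, j) = t' i j * A $$ (i, j) + (1 - t' i j) * B $$ (i, j)"
    using C carrier_matD[OF A] unfolding interval_hull_def by auto
  then obtain t where t: "0 \<le> t" "t \<le> 1" "C $$ (i, j) = t * A $$ (i, j) + (1 - t) * B $$ (i, j)"
    using ij by (metis atLeastAtMost_iff)
  have "C $$ (i, j) \<le> t * max (A $$ (i, j)) (B $$ (i, j)) + (1 - t) * max (A $$ (i, j)) (B $$ (i, j))"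
    unfolding t(3) using t by (intro add_mono mult_left_mono) auto
  then show "C $$ (i, j) \<le> max (A $$ (i, j)) (B $$ (i, j))" by (simp add: algebra_simps)
  have "t * min (A $$ (i, j)) (B $$ (i, j)) + (1 - t) * min (A $$ (i, j)) (B $$ (i, j)) \<le> C $$ (i, j)"
    unfolding t(3) using t by (intro add_mono mult_left_mono) auto
  then show "min (A $$ (i, j)) (B $$ (i, j)) \<le> C $$ (i, j)" by (simp add: algebra_simps)
qed

text \<open>Midpoint-radius form of the interval, matching the shape of
  \<open>I_z_index\<close>.\<close>

lemma interval_hull_dist_center:
  assumes "A \<in> carrier_mat n n" "C \<in> interval_hull A B" "i < n" "j < n"
  shows "\<bar>C $$ (i, j) - (A $$ (i, j) + B $$ (i, j)) / 2\<bar> \<le> \<bar>A $$ (i, j) - B $$ (i, j)\<bar> / 2"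
proof -
  have "\<bar>c - (a + b) / 2\<bar> \<le> \<bar>a - b\<bar> / 2" if "min a b \<le> c" "c \<le> max a b" for a b c :: real
    using that by (cases "a \<le> b") (auto simp: abs_le_iff field_simps)
  then show ?thesis using interval_hull_index_bounds[OF assms] by blast
qed

text \<open>\<open>e_vec n J\<close> and its negative have the same pairwise products, so one
  deviating product excludes both.\<close>

lemma sign_vec_not_block:
  assumes "i < n" "j < n" and "z $ i * z $ j \<noteq> block_sign J i * block_sign J j"
  shows "z \<notin> {e_vec n J, - e_vec n J}"
  using assms by (auto simp: e_vec_def block_sign_def)

text \<open>When \<open>z\<close> carries the signs of \<open>x\<close>, \<open>I_z\<close>
  minimises each term \<open>x i * C $$ (i, j) * x j\<close> over the hull.\<close>

lemma reverses_signs_I_z: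
  assumes A: "A \<in> carrier_mat n n" and B: "B \<in> carrier_mat n n" and C: "C \<in> interval_hull A B"
    and z: "z \<in> sign_vecs n" and zx: "\<And>i. i < n \<Longrightarrow> z $ i * x i = \<bar>x i\<bar>"
    and rev: "reverses_signs n (\<lambda>i j. C $$ (i, j)) x"
  shows "reverses_signs n (\<lambda>i j. I_z A B z $$ (i, j)) x"
  unfolding reverses_signs_def
proof (intro allI impI)
  fix i assume i: "i < n"
  have zc: "z \<in> carrier_vec n" using z by (simp add: sign_vecs_def)
  have "x i * (I_z A B z $$ (i, j) * x j) \<le> x i * (C $$ (i, j) * x j)" if j: "j < n" for j
  proof -
    let ?c = "(A $$ (i, j) + B $$ (i, j)) / 2" and ?r = "\<bar>A $$ (i, j) - B $$ (i, j)\<bar> / 2"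
    have "x i * (I_z A B z $$ (i, j) * x j) = x i * x j * ?c - (z $ i * x i) * (z $ j * x j) * ?r"
      unfolding I_z_index[OF A B zc i j] by (simp add: algebra_simps)
    also have "\<dots> = x i * x j * ?c - \<bar>x i * x j\<bar> * ?r"
      using zx i j by (simp add: abs_mult)
    also have "\<dots> \<le> x i * x j * ?c - \<bar>x i * x j\<bar> * \<bar>C $$ (i, j) - ?c\<bar>"
      using interval_hull_dist_center[OF A C i j]
      by (intro diff_mono mult_left_mono order_refl abs_ge_zero)
    also have "\<dots> \<le> x i * x j * ?c + x i * x j * (C $$ (i, j) - ?c)"
      using abs_ge_minus_self[of "x i * x j * (C $$ (i, j) - ?c)"] by (simp only: abs_mult)
    also have "\<dots> = x i * (C $$ (i, j) * x j)" by (simp add: right_diff_distrib)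
    finally show ?thesis .
  qed
  then have "x i * (\<Sum>j<n. I_z A B z $$ (i, j) * x j) \<le> x i * (\<Sum>j<n. C $$ (i, j) * x j)"
    unfolding sum_distrib_left by (intro sum_mono) auto
  also have "\<dots> \<le> 0" using rev i by (simp add: reverses_signs_def)
  finally show "x i * (\<Sum>j<n. I_z A B z $$ (i, j) * x j) \<le> 0" .
qed

theorem theorem3p8:
  fixes n :: nat and J :: "nat set" and A B :: "real mat"
  assumes J: "J \<noteq> {}" "J \<subset> {..<n}"
    and A: "A \<in> carrier_mat n n"
    and B: "B \<in> carrier_mat n n"
    and diag: "\<forall>i < n. max (A $$ (i, i)) (B $$ (i, i)) < 0"
  shows "(\<forall>C \<in> interval_hull A B. N_matrix_first_category J C) \<longleftrightarrow>
    (\<forall>z \<in> sign_vecs n - {e_vec n J, - e_vec n J}. N_matrix_first_category J (I_z A B z))"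
proof
  assume "\<forall>C \<in> interval_hull A B. N_matrix_first_category J C"
  then show "\<forall>z \<in> sign_vecs n - {e_vec n J, - e_vec n J}. N_matrix_first_category J (I_z A B z)"
    using I_z_in_interval_hull[OF A B] by blast
next
  assume Iz: "\<forall>z \<in> sign_vecs n - {e_vec n J, - e_vec n J}. N_matrix_first_category J (I_z A B z)"
  let ?s = "block_sign J"
  have Jn: "J \<subseteq> {..<n}" using J by auto
  show "\<forall>C \<in> interval_hull A B. N_matrix_first_category J C"
  proof
    fix C assume C: "C \<in> interval_hull A B"
    then have "C \<in> carrier_mat n n" using A by (simp add: interval_hull_def)
    moreover have "?s i * ?s j * C $$ (i, j) < 0" if ij: "i < n" "j < n" for i j
    \<comment> \<open>On the diagonal \<open>z $ i * z $ i = 1\<close>, so \<open>I_z\<close> only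
      shows lower endpoints; the upper ones are controlled by \<open>diag\<close>.\<close>
    proof (cases "i = j")
      case True
      then have "C $$ (i, j) < 0"
        using interval_hull_index_bounds(2)[OF A C ij] diag ij le_less_trans by blast
      then show ?thesis using True by (simp add: block_sign_def)
    next
      case False
      \<comment> \<open>Chosen so that \<open>I_z\<close> has at \<open>(i, j)\<close> the endpoint
        maximising \<open>?s i * ?s j * C $$ (i, j)\<close>; the same product rules out both
        excluded vectors.\<close>
      define z where "z = vec n (\<lambda>k. if k = j then - (?s i * ?s j) else 1)"
      have z: "z \<in> sign_vecs n" by (auto simp: sign_vecs_def z_def block_sign_def)
      then have zc: "z \<in> carrier_vec n" by (simp add: sign_vecs_def)
      have zz: "z $ i * z $ j = - (?s i * ?s j)" using False ij by (simp add: z_def)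
      then have "z \<notin> {e_vec n J, - e_vec n J}"
        using ij by (intro sign_vec_not_block[of i n j]) (auto simp: block_sign_def split: if_splits)
      then have neg: "?s i * ?s j * I_z A B z $$ (i, j) < 0"
        using Iz z ij N_matrix_first_category_iff[OF I_z_carrier[OF A B zc] Jn] by blast
      note center = interval_hull_dist_center[OF A C ij]
      have "?s i * ?s j = 1 \<or> ?s i * ?s j = -1" by (simp add: block_sign_def)
      then show ?thesis
      proof
        assume w: "?s i * ?s j = 1"
        show ?thesis
          using neg abs_le_D1[OF center] abs_le_D2[OF center]
          unfolding I_z_index[OF A B zc ij] zz w by argo
      next
        assume w: "?s i * ?s j = -1"
        show ?thesis
          using neg abs_le_D1[OF center] abs_le_D2[OF center]
          unfolding I_z_index[OF A B zc ij] zz w by argo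
      qed
    qed
    moreover have "\<not> reverses_signs n (\<lambda>i j. C $$ (i, j)) x"
      if mixed: "mixed_signs n (\<lambda>i. ?s i * x i)" for x
    proof
      assume rev: "reverses_signs n (\<lambda>i j. C $$ (i, j)) x"
      \<comment> \<open>The signs of \<open>x\<close>, with 1 at its zeros. Mixed signs make
        \<open>z\<close> agree with \<open>?s\<close> at \<open>p\<close> and oppose it at
        \<open>q\<close>.\<close>
      define z where "z = vec n (\<lambda>i. if x i < 0 then - 1 else (1::real))"
      have z: "z \<in> sign_vecs n" by (auto simp: sign_vecs_def z_def)
      then have zc: "z \<in> carrier_vec n" by (simp add: sign_vecs_def)
      obtain p q where pq: "p < n" "q < n" "0 < ?s p * x p" "?s q * x q < 0"
        using mixed by (auto simp: mixed_signs_def)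
      then have "z $ p = ?s p" "z $ q = - ?s q"
        by (auto simp: z_def block_sign_def split: if_splits)
      then have "z \<notin> {e_vec n J, - e_vec n J}"
        using pq by (intro sign_vec_not_block[of p n q]) (auto simp: block_sign_def)
      then have "\<not> reverses_signs n (\<lambda>i j. I_z A B z $$ (i, j)) x"
        using Iz z mixed N_matrix_first_category_iff[OF I_z_carrier[OF A B zc] Jn] by blast
      moreover have "reverses_signs n (\<lambda>i j. I_z A B z $$ (i, j)) x"
        by (rule reverses_signs_I_z[OF A B C z _ rev]) (simp add: z_def)
      ultimately show False by blast
    qed
    ultimately show "N_matrix_first_category J C"
      using N_matrix_first_category_iff[OF _ Jn] by blast
  qed
qed

end
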